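(* Let $S_{r,N}$ be an atomic exponential Puiseux semiring. The following are equivalent: (1) $r\ge1$; (2) $S_{r,N}$ satisfies the ascending chain condition on principal ideals; (3) $S_{r,N}$ is ACCP-presentable; (4) $\omega(a)<\infty$ for every atom $a$ of $S_{r,N}$.
   Context: $\mathbb{N}=\{0,1,2,\dots\}$. A numerical monoid $N$ is an additive submonoid of $\mathbb{N}$ with finite complement. For $r\in\mathbb{Q}_{>0}$ write $r=\mathsf{n}(r)/\mathsf{d}(r)$ in lowest terms. The exponential Puiseux semiring $S_{r,N}$ is the additive submonoid of $\mathbb{Q}_{\ge0}$ generated by $\{r^k:k\in N\}$ (equal to $\mathbb{N}$ if $r\in\mathbb{N}$; for $r\notin\mathbb{N}$ atomic iff $\mathsf{n}(r)>1$). A monoid satisfies ACCP if every ascending chain of principal ideals $x+M$ stabilizes. For an atomic monoid $M$: $\mathsf{Z}(M)$ is the free commutative monoid on the atoms, $\pi:\mathsf{Z}(M)\to M$ the evaluation map, and $\sim_M=\{(z,z'):\pi(z)=\pi(z')\}$. A presentation of $M$ is a subset $\sigma\subseteq\mathsf{Z}(M)\times\mathsf{Z}(M)$ such that the smallest congruence on $\mathsf{Z}(M)$ containing $\sigma$ equals $\sim_M$. Two factorizations of the same element are $\mathcal{R}$-related if joined by a chain of factorizations of that element in which consecutive ones share an atom. For a binary relation $\sigma$ on $\mathsf{Z}(M)$, $G_\sigma$ is the graph whose vertices are the $\mathcal{R}$-classes and with an edge between distinct classes $R,R'$ when $(z,z')\in\sigma\cup\sigma^{-1}$ for some $z\in R$,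 $z'\in R'$. $M$ is ACCP-presentable if a subset $\sigma'\subseteq\sim_M$ is a presentation of $M$ if and only if for every $x\in M$ all $\mathcal{R}$-classes of $\pi^{-1}(x)$ lie in one connected component of $G_{\sigma'}$. For nonzero $x\in M$, $\omega(x)$ is the smallest $n\in\mathbb{N}\cup\{\infty\}$ such that whenever $x$ divides $a_1+\cdots+a_m$ (atoms $a_i$), $x$ divides a sub-sum of at most $n$ of the $a_i$. *)

theory Defs
  imports Main "HOL-Library.Multiset" "HOL-Library.Extended_Nat"
begin

text \<open>Numerical monoid: additive submonoid of the naturals with finite complement.\<close>
definition numerical_monoid :: "nat set \<Rightarrow> bool" where
  "numerical_monoid N \<longleftrightarrow> 0 \<in> N \<and> (\<forall>a\<in>N. \<forall>b\<in>N. a + b \<in> N) \<and> finite (UNIV - N)"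

text \<open>Exponential Puiseux semiring: additive submonoid of the rationals generated by r^k, k in N.\<close>
inductive_set exp_puiseux :: "rat \<Rightarrow> nat set \<Rightarrow> rat set" for r :: rat and N :: "nat set" where
  zero: "0 \<in> exp_puiseux r N"
| step: "x \<in> exp_puiseux r N \<Longrightarrow> k \<in> N \<Longrightarrow> x + r ^ k \<in> exp_puiseux r N"

text \<open>Generic notions for an additive submonoid M of the rationals.\<close>
definition mdvd :: "rat set \<Rightarrow> rat \<Rightarrow> rat \<Rightarrow> bool" where
  "mdvd M x y \<longleftrightarrow> (\<exists>c\<in>M. y = x + c)"

definition munits :: "rat set \<Rightarrow> rat set" where
  "munits M = {u \<in> M. \<exists>v\<in>M. u + v = 0}"

definition atoms :: "rat set \<Rightarrow> rat set" where
  "atoms M = {a \<in> M. a \<notin> munits M \<and>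
      (\<forall>x\<in>M. \<forall>y\<in>M. a = x + y \<longrightarrow> x \<in> munits M \<or> y \<in> munits M)}"

text \<open>Z(M): the free commutative monoid on the atoms, as multisets of atoms; pi = sum_mset.\<close>
definition factorizations :: "rat set \<Rightarrow> rat multiset set" where
  "factorizations M = {z. set_mset z \<subseteq> atoms M}"

definition fact_of :: "rat set \<Rightarrow> rat \<Rightarrow> rat multiset set" where
  "fact_of M x = {z \<in> factorizations M. sum_mset z = x}"

definition atomic :: "rat set \<Rightarrow> bool" where
  "atomic M \<longleftrightarrow> (\<forall>x\<in>M. x \<notin> munits M \<longrightarrow> (\<exists>z \<in> factorizations M. sum_mset z = x))"

text \<open>ACCP: every ascending chain of principal ideals x_n + M stabilizes.
  x_n + M \<subseteq> x_(n+1) + M iff x_(n+1) divides x_n.\<close>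
definition accp :: "rat set \<Rightarrow> bool" where
  "accp M \<longleftrightarrow> (\<forall>f :: nat \<Rightarrow> rat. (\<forall>n. f n \<in> M) \<and> (\<forall>n. mdvd M (f (Suc n)) (f n)) \<longrightarrow>
      (\<exists>n0. \<forall>n\<ge>n0. mdvd M (f n) (f (Suc n))))"

text \<open>The kernel congruence ~_M.\<close>
definition kernel :: "rat set \<Rightarrow> (rat multiset \<times> rat multiset) set" where
  "kernel M = {(z, z'). z \<in> factorizations M \<and> z' \<in> factorizations M \<and> sum_mset z = sum_mset z'}"

definition is_congruence :: "rat set \<Rightarrow> (rat multiset \<times> rat multiset) set \<Rightarrow> bool" where
  "is_congruence M \<rho> \<longleftrightarrow> \<rho> \<subseteq> factorizations M \<times> factorizations M
     \<and> (\<forall>z\<in>factorizations M. (z, z) \<in> \<rho>) \<and> sym \<rho> \<and> trans \<rho>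
     \<and> (\<forall>(z, z')\<in>\<rho>. \<forall>w\<in>factorizations M. (z + w, z' + w) \<in> \<rho>)"

definition presentation :: "rat set \<Rightarrow> (rat multiset \<times> rat multiset) set \<Rightarrow> bool" where
  "presentation M \<sigma> \<longleftrightarrow> \<sigma> \<subseteq> factorizations M \<times> factorizations M
     \<and> \<Inter>{\<rho>. is_congruence M \<rho> \<and> \<sigma> \<subseteq> \<rho>} = kernel M"

text \<open>R-relation: factorizations of the same element sharing an atom; R-classes via
  reflexive transitive closure.\<close>
definition Rrel :: "rat set \<Rightarrow> (rat multiset \<times> rat multiset) set" where
  "Rrel M = {(z, z'). z \<in> factorizations M \<and> z' \<in> factorizations M
      \<and> sum_mset z = sum_mset z' \<and> z \<inter># z' \<noteq> {#}}"

definition Rclass :: "rat set \<Rightarrow> rat multiset \<Rightarrow> rat multiset set" where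
  "Rclass M z = {z'. (z, z') \<in> (Rrel M)\<^sup>*}"

definition Rclasses :: "rat set \<Rightarrow> rat multiset set set" where
  "Rclasses M = Rclass M ` factorizations M"

text \<open>Edges of the graph G_sigma.\<close>
definition Gedge :: "rat set \<Rightarrow> (rat multiset \<times> rat multiset) set \<Rightarrow> (rat multiset set \<times> rat multiset set) set" where
  "Gedge M \<sigma> = {(R, R'). R \<in> Rclasses M \<and> R' \<in> Rclasses M \<and> R \<noteq> R'
      \<and> (\<exists>z\<in>R. \<exists>z'\<in>R'. (z, z') \<in> \<sigma> \<union> \<sigma>\<inverse>)}"

definition accp_presentable :: "rat set \<Rightarrow> bool" where
  "accp_presentable M \<longleftrightarrow> (\<forall>\<sigma>. \<sigma> \<subseteq> kernel M \<longrightarrow>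
     (presentation M \<sigma> \<longleftrightarrow>
       (\<forall>x\<in>M. \<forall>R\<in>Rclass M ` fact_of M x. \<forall>R'\<in>Rclass M ` fact_of M x. (R, R') \<in> (Gedge M \<sigma>)\<^sup>*)))"

text \<open>omega(x) in N \<union> {\<infinity>}; Inf of the empty set of enat is \<infinity>.\<close>
definition omega :: "rat set \<Rightarrow> rat \<Rightarrow> enat" where
  "omega M x = Inf (enat ` {n. \<forall>z\<in>factorizations M. mdvd M x (sum_mset z) \<longrightarrow>
       (\<exists>w. w \<subseteq># z \<and> size w \<le> n \<and> mdvd M x (sum_mset w))})"

end

theory Submission
  imports Defs
begin

text \<open>Write r = n/d in lowest terms. If \<open>r \<ge> 1\<close>, nonzero elements are at least 1, which gives
  ACCP, and ACCP implies ACCP-presentability in general by well-founded induction along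
  divisibility. For omega, a factorization divisible by \<open>r\<^sup>k\<close> is scanned from its highest power
  down: remainders modulo d of the multiplicities of high powers are irrelevant, while blocks of
  d equal powers can be traded downwards, and boundedly many of them are already divisible by
  \<open>r\<^sup>k\<close>.

  If \<open>r < 1\<close>, the elements \<open>n r\<^sup>k\<close> form a strictly descending divisor chain, and 1 divides
  \<open>d\<^sup>j r\<^sup>j = n\<^sup>j\<close> but no sub-sum of few copies of \<open>r\<^sup>j\<close>. The kernel is generated by the trades
  between consecutive powers. Replacing the trade of \<open>n r\<^sup>k\<close> for \<open>d r\<^sup>k\<^sup>+\<^sup>1\<close> by that for
  \<open>(d - n) r\<^sup>k\<^sup>+\<^sup>1 + d r\<^sup>k\<^sup>+\<^sup>2\<close> leaves the R-classes connected but no longer generates the kernel,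
  as a weight with alternating signs shows.\<close>

section \<open>Presentations and R-classes\<close>

text \<open>Turns the connectedness condition on the graph into an inclusion of relations,
  \<open>kernel M \<subseteq> class_rel M \<sigma>\<close>.\<close>

definition class_rel ::
  "rat set \<Rightarrow> (rat multiset \<times> rat multiset) set \<Rightarrow> (rat multiset \<times> rat multiset) set" where
  "class_rel M \<sigma> = {(z, z') \<in> kernel M. (Rclass M z, Rclass M z') \<in> (Gedge M \<sigma>)\<^sup>*}"

lemma factorizations_add:
  "z \<in> factorizations M \<Longrightarrow> w \<in> factorizations M \<Longrightarrow> z + w \<in> factorizations M"
  by (auto simp: factorizations_def)

lemma sum_mset_factorization_in:
  assumes "0 \<in> M" and "\<And>x y. x \<in> M \<Longrightarrow> y \<in> M \<Longrightarrow> x + y \<in> M"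
    and "z \<in> factorizations M"
  shows "sum_mset z \<in> M"
  using assms(3)
proof (induction z)
  case (add a z)
  then show ?case
    using assms(2) by (auto simp: factorizations_def atoms_def)
qed (simp add: assms(1))

lemma sym_Rrel: "sym (Rrel M)"
  by (auto simp: sym_def Rrel_def subset_mset.inf.commute)

lemma sym_Gedge: "sym (Gedge M \<sigma>)"
  unfolding sym_def Gedge_def by blast

lemma Rclass_eq:
  assumes "(z, z') \<in> (Rrel M)\<^sup>*"
  shows "Rclass M z = Rclass M z'"
proof -
  have "(z', z) \<in> (Rrel M)\<^sup>*"
    using assms sym_rtrancl[OF sym_Rrel] by (auto dest: symD)
  with assms show ?thesis
    by (auto simp: Rclass_def intro: rtrancl_trans)
qed

lemma Rrel_subset_class_rel: "Rrel M \<subseteq> class_rel M \<sigma>"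
proof
  fix p assume "p \<in> Rrel M"
  then obtain z z' where p: "p = (z, z')" "(z, z') \<in> Rrel M"
    by (cases p) auto
  then have "Rclass M z = Rclass M z'"
    by (intro Rclass_eq) auto
  with p show "p \<in> class_rel M \<sigma>"
    by (auto simp: class_rel_def Rrel_def kernel_def)
qed

lemma relation_subset_class_rel:
  assumes "\<sigma> \<subseteq> kernel M"
  shows "\<sigma> \<subseteq> class_rel M \<sigma>"
proof
  fix p assume p: "p \<in> \<sigma>"
  obtain z z' where zz: "p = (z, z')" by (cases p)
  have k: "(z, z') \<in> kernel M" using p zz assms by auto
  have "z \<in> Rclass M z" "z' \<in> Rclass M z'" by (auto simp: Rclass_def)
  then have "Rclass M z = Rclass M z' \<or> (Rclass M z, Rclass M z') \<in> Gedge M \<sigma>"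
    using p zz k by (auto simp: Gedge_def Rclasses_def kernel_def)
  then show "p \<in> class_rel M \<sigma>"
    using k zz by (auto simp: class_rel_def)
qed

lemma kernel_congruence: "is_congruence M (kernel M)"
  by (auto simp: is_congruence_def kernel_def sym_def trans_def factorizations_add)

text \<open>Adding a nonempty \<open>w\<close> to both members of a kernel pair puts them into one
  R-class, since they then share an atom of \<open>w\<close>; compatibility with addition is thus
  automatic.\<close>

lemma class_rel_congruence: "is_congruence M (class_rel M \<sigma>)"
proof -
  have "sym (class_rel M \<sigma>)"
    using sym_rtrancl[OF sym_Gedge, of M \<sigma>]
    by (auto simp: sym_def class_rel_def kernel_def)
  moreover have "trans (class_rel M \<sigma>)"
    unfolding trans_def class_rel_def kernel_def by (auto intro: rtrancl_trans)
  moreover have "(z + w, z' + w) \<in> class_rel M \<sigma>"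
    if zz: "(z, z') \<in> class_rel M \<sigma>" and w: "w \<in> factorizations M" for z z' w
  proof (cases "w = {#}")
    case False
    then obtain a where a: "a \<in># w" by (meson multiset_nonemptyE)
    then have "a \<in># (z + w) \<inter># (z' + w)" by simp
    then have "(z + w) \<inter># (z' + w) \<noteq> {#}" by force
    then have "(z + w, z' + w) \<in> Rrel M"
      using zz w by (auto simp: class_rel_def kernel_def Rrel_def factorizations_add)
    then show ?thesis using Rrel_subset_class_rel by blast
  qed (use zz in simp)
  ultimately show ?thesis
    by (auto simp: is_congruence_def class_rel_def kernel_def)
qed

text \<open>\<open>class_rel M \<sigma>\<close> is a congruence containing \<open>\<sigma>\<close>,
  so a presentation always connects the R-classes. Only the converse can fail.\<close>

lemma presentation_imp_class_rel:
  assumes "\<sigma> \<subseteq> kernel M" and "presentation M \<sigma>"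
  shows "kernel M \<subseteq> class_rel M \<sigma>"
  using assms class_rel_congruence relation_subset_class_rel[OF assms(1)]
  unfolding presentation_def by blast

lemma accp_presentable_iff:
  assumes "0 \<in> M" and "\<And>x y. x \<in> M \<Longrightarrow> y \<in> M \<Longrightarrow> x + y \<in> M"
  shows "accp_presentable M \<longleftrightarrow>
    (\<forall>\<sigma> \<subseteq> kernel M. kernel M \<subseteq> class_rel M \<sigma> \<longrightarrow> presentation M \<sigma>)"
proof -
  have graph: "(\<forall>x\<in>M. \<forall>R\<in>Rclass M ` fact_of M x. \<forall>R'\<in>Rclass M ` fact_of M x. (R, R') \<in> (Gedge M \<sigma>)\<^sup>*)
      \<longleftrightarrow> kernel M \<subseteq> class_rel M \<sigma>" for \<sigma>
    using sum_mset_factorization_in[of M, OF assms]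
    by (auto simp: fact_of_def class_rel_def kernel_def subset_iff)
  show ?thesis
    unfolding accp_presentable_def graph using presentation_imp_class_rel by meson
qed

section \<open>ACCP and well-founded induction along divisibility\<close>

lemma accp_imp_wf:
  assumes "accp M"
  shows "wf {(y, x). x \<in> M \<and> y \<in> M \<and> mdvd M y x \<and> \<not> mdvd M x y}"
  unfolding wf_iff_no_infinite_down_chain
proof
  assume "\<exists>f. \<forall>i. (f (Suc i), f i) \<in> {(y, x). x \<in> M \<and> y \<in> M \<and> mdvd M y x \<and> \<not> mdvd M x y}"
  then obtain f where "\<And>i. f i \<in> M \<and> mdvd M (f (Suc i)) (f i) \<and> \<not> mdvd M (f i) (f (Suc i))"
    by blast
  with assms show False unfolding accp_def by (meson order_refl)
qed

text \<open>Induction on the common value \<open>x\<close>. A path in the graph consists of R-steps,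
  where a shared atom is cancelled and the induction hypothesis applies, and of edges, which come
  from \<open>\<sigma>\<close> up to symmetry.\<close>

theorem accp_imp_accp_presentable:
  assumes "0 \<in> M" and add: "\<And>x y. x \<in> M \<Longrightarrow> y \<in> M \<Longrightarrow> x + y \<in> M" and "accp M"
  shows "accp_presentable M"
proof -
  have sum_in: "sum_mset z \<in> M" if "z \<in> factorizations M" for z
    using assms(1) add that by (rule sum_mset_factorization_in)
  have *: "kernel M \<subseteq> \<rho>"
    if \<sigma>: "\<sigma> \<subseteq> kernel M" and conn: "kernel M \<subseteq> class_rel M \<sigma>"
      and cong: "is_congruence M \<rho>" and sub: "\<sigma> \<subseteq> \<rho>" for \<sigma> \<rho>
  proof -
    have refl: "(z, z) \<in> \<rho>" if "z \<in> factorizations M" for z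
      using cong that by (auto simp: is_congruence_def)
    have sym: "(z', z) \<in> \<rho>" if "(z, z') \<in> \<rho>" for z z'
      using cong that by (auto simp: is_congruence_def dest: symD)
    have trans: "(z, v) \<in> \<rho>" if "(z, u) \<in> \<rho>" "(u, v) \<in> \<rho>" for z u v
      using cong that unfolding is_congruence_def by (meson transD)
    have "\<forall>z \<in> fact_of M x. \<forall>z' \<in> fact_of M x. (z, z') \<in> \<rho>" for x
    proof (induction x rule: wf_induct_rule[OF accp_imp_wf[OF \<open>accp M\<close>]])
      case (1 x)
      have step: "(z, z') \<in> \<rho>" if "(z, z') \<in> Rrel M" "sum_mset z = x" for z z'
      proof -
        have "z \<inter># z' \<noteq> {#}"
          using that by (simp add: Rrel_def)
        then obtain a where "a \<in># z \<inter># z'"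
          by (meson multiset_nonemptyE)
        then have "a \<in># z" "a \<in># z'" by auto
        then obtain u u' where u: "z = add_mset a u" "z' = add_mset a u'"
          by (meson mset_add)
        have fac: "a \<in> atoms M" "u \<in> factorizations M" "u' \<in> factorizations M"
          and eq: "sum_mset u = sum_mset u'"
          using that(1) u by (auto simp: Rrel_def factorizations_def)
        have aM: "a \<in> M" "a \<notin> munits M" using fac(1) by (auto simp: atoms_def)
        have "mdvd M (sum_mset u) x"
          using that(2) u aM by (auto simp: mdvd_def)
        \<comment> \<open>Otherwise \<open>a\<close> plus some element of \<open>M\<close> would be
          0, making the atom \<open>a\<close> a unit.\<close>
        moreover have "\<not> mdvd M x (sum_mset u)"
          using that(2) u aM by (auto simp: mdvd_def munits_def)
        moreover have "x \<in> M" "sum_mset u \<in> M"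
          using sum_in fac that(2) u add aM by auto
        ultimately have "(u, u') \<in> \<rho>"
          using 1[of "sum_mset u"] fac eq by (auto simp: fact_of_def)
        moreover have "{#a#} \<in> factorizations M"
          using fac by (simp add: factorizations_def)
        ultimately have "(u + {#a#}, u' + {#a#}) \<in> \<rho>"
          using cong unfolding is_congruence_def by fastforce
        then show ?thesis using u by simp
      qed
      have steps: "(z, z') \<in> \<rho> \<and> z' \<in> fact_of M x"
        if "(z, z') \<in> (Rrel M)\<^sup>*" "z \<in> fact_of M x" for z z'
        using that(1)
      proof (induction rule: rtrancl_induct)
        case base
        then show ?case using refl that(2) by (auto simp: fact_of_def)
      next
        case (step u v)
        then show ?case
          using \<open>\<And>z z'. (z, z') \<in> Rrel M \<Longrightarrow> sum_mset z = x \<Longrightarrow> (z, z') \<in> \<rho>\<close>[of u v] trans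
          by (auto simp: fact_of_def Rrel_def)
      qed
      \<comment> \<open>The claim covers every member of the class reached, because the next edge
        may leave from any of them.\<close>
      have path: "\<forall>z' \<in> R. (z, z') \<in> \<rho> \<and> z' \<in> fact_of M x"
        if "(Rclass M z, R) \<in> (Gedge M \<sigma>)\<^sup>*" "z \<in> fact_of M x" for z R
        using that(1)
      proof (induction rule: rtrancl_induct)
        case base
        then show ?case using steps that(2) by (auto simp: Rclass_def)
      next
        case (step R R')
        then obtain u u' v where uu: "u \<in> R" "u' \<in> R'" "(u, u') \<in> \<sigma> \<union> \<sigma>\<inverse>"
          and R': "R' = Rclass M v"
          by (auto simp: Gedge_def Rclasses_def)
        have "(u, u') \<in> \<rho>" "u' \<in> fact_of M x"
          using uu step.IH sub sym \<sigma> by (auto simp: kernel_def fact_of_def)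
        moreover have "R' = Rclass M u'"
          using uu(2) Rclass_eq unfolding R' by (auto simp: Rclass_def)
        ultimately show ?case
          using steps[of u'] step.IH uu(1) trans by (auto simp: Rclass_def)
      qed
      show ?case
      proof (intro ballI)
        fix z z' assume z: "z \<in> fact_of M x" and z': "z' \<in> fact_of M x"
        then have "(z, z') \<in> class_rel M \<sigma>"
          using conn by (auto simp: fact_of_def kernel_def)
        moreover have "z' \<in> Rclass M z'" by (simp add: Rclass_def)
        ultimately show "(z, z') \<in> \<rho>"
          using path z by (auto simp: class_rel_def)
      qed
    qed
    then show ?thesis
      by (auto simp: kernel_def fact_of_def)
  qed
  have iff: "accp_presentable M \<longleftrightarrow>
      (\<forall>\<sigma> \<subseteq> kernel M. kernel M \<subseteq> class_rel M \<sigma> \<longrightarrow> presentation M \<sigma>)"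
    using assms(1) add by (rule accp_presentable_iff)
  show ?thesis
    unfolding iff presentation_def
  proof (intro allI impI conjI)
    fix \<sigma> assume \<sigma>: "\<sigma> \<subseteq> kernel M" "kernel M \<subseteq> class_rel M \<sigma>"
    show "\<sigma> \<subseteq> factorizations M \<times> factorizations M"
      using \<sigma>(1) by (auto simp: kernel_def)
    show "\<Inter> {\<rho>. is_congruence M \<rho> \<and> \<sigma> \<subseteq> \<rho>} = kernel M"
      using \<sigma> * kernel_congruence by blast
  qed
qed

lemma omega_finite_iff:
  "omega M x < \<infinity> \<longleftrightarrow> (\<exists>B. \<forall>z\<in>factorizations M. mdvd M x (sum_mset z) \<longrightarrow>
       (\<exists>w. w \<subseteq># z \<and> size w \<le> B \<and> mdvd M x (sum_mset w)))"
    (is "_ \<longleftrightarrow> (\<exists>B. ?P B)")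
proof -
  have "Inf (enat ` {B. ?P B}) < \<infinity> \<longleftrightarrow> (\<exists>B. ?P B)"
    unfolding Inf_less_iff by auto
  then show ?thesis by (simp add: omega_def)
qed

section \<open>Exponential Puiseux semirings\<close>

lemma split_at:
  fixes i :: nat
  shows "A = filter_mset (\<lambda>j. j < i) A + replicate_mset (count A i) i + filter_mset (\<lambda>j. i < j) A"
proof (rule multiset_eqI)
  fix x
  show "count A x = count (filter_mset (\<lambda>j. j < i) A + replicate_mset (count A i) i
      + filter_mset (\<lambda>j. i < j) A) x"
    by (cases x i rule: linorder_cases) auto
qed

lemma filter_less_cong:
  fixes i :: nat
  assumes "\<forall>l < i. count A l = count B l"
  shows "filter_mset (\<lambda>j. j < i) A = filter_mset (\<lambda>j. j < i) B"
  using assms by (intro multiset_eqI) auto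

lemma replicate_mset_add: "replicate_mset (p + q) x = replicate_mset p x + replicate_mset q x"
  by (rule multiset_eqI) simp

locale exponential_puiseux =
  fixes n d :: nat and N :: "nat set" and r :: rat
  assumes r_def: "r = of_nat n / of_nat d"
    and coprime: "coprime n d" and n_pos: "n > 0" and d_pos: "d > 0"
    and numerical: "numerical_monoid N"
begin

abbreviation S :: "rat set" where "S \<equiv> exp_puiseux r N"

text \<open>Multisets of exponents represent elements whether or not the powers are atoms, and keep
  exponents apart even for r = 1, where all powers coincide.\<close>

definition val :: "nat multiset \<Rightarrow> rat" where
  "val A = (\<Sum>i\<in>#A. r ^ i)"

definition supported :: "nat \<Rightarrow> nat multiset \<Rightarrow> bool" where
  "supported j A \<longleftrightarrow> set_mset A \<subseteq> N \<inter> {..j}"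

lemma r_pos: "r > 0"
  using n_pos d_pos by (simp add: r_def)

lemma r_power_mult: "of_nat d * r ^ Suc k = of_nat n * r ^ k"
  using d_pos by (simp add: r_def field_simps)

lemma r_power_d: "r ^ k * of_nat d ^ k = of_nat n ^ k"
  using d_pos by (simp add: r_def power_divide)

lemma zero_in_N: "0 \<in> N"
  using numerical by (simp add: numerical_monoid_def)

lemma conductor: obtains K where "\<And>j. j \<ge> K \<Longrightarrow> j \<in> N"
proof -
  have "finite (UNIV - N)" using numerical by (simp add: numerical_monoid_def)
  then obtain K where "\<forall>j \<in> UNIV - N. j < K"
    using finite_nat_set_iff_bounded by blast
  then show ?thesis using that by (metis DiffI UNIV_I leD)
qed

lemma val_empty [simp]: "val {#} = 0"
  and val_add_mset [simp]: "val (add_mset i A) = r ^ i + val A"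
  and val_union [simp]: "val (A + B) = val A + val B"
  by (simp_all add: val_def)

lemma val_replicate [simp]: "val (replicate_mset q i) = of_nat q * r ^ i"
  by (induction q) (auto simp: algebra_simps)

lemma val_nonneg: "val A \<ge> 0"
  by (induction A) (use r_pos in \<open>auto intro: add_nonneg_nonneg\<close>)

lemma val_pos: "A \<noteq> {#} \<Longrightarrow> val A > 0"
  by (induction A) (use r_pos val_nonneg in \<open>auto intro: add_pos_nonneg\<close>)

lemma S_eq: "S = val ` {A. set_mset A \<subseteq> N}"
proof (intro set_eqI iffI)
  fix x assume "x \<in> S"
  then show "x \<in> val ` {A. set_mset A \<subseteq> N}"
  proof induction
    case zero
    then show ?case by (intro image_eqI[where x = "{#}"]) auto
  next
    case (step x k)
    then obtain A where "set_mset A \<subseteq> N" "x = val A" by auto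
    with step show ?case by (intro image_eqI[where x = "add_mset k A"]) auto
  qed
next
  fix x assume "x \<in> val ` {A. set_mset A \<subseteq> N}"
  then obtain A where "set_mset A \<subseteq> N" "x = val A" by auto
  then show "x \<in> S"
  proof (induction A arbitrary: x)
    case (add k A)
    then show ?case using exp_puiseux.step[of "val A" r N k] by (simp add: add.commute)
  qed (auto intro: exp_puiseux.zero)
qed

lemma val_in_S: "set_mset A \<subseteq> N \<Longrightarrow> val A \<in> S"
  by (auto simp: S_eq)

lemma S_add: "x \<in> S \<Longrightarrow> y \<in> S \<Longrightarrow> x + y \<in> S"
proof -
  assume "x \<in> S" "y \<in> S"
  then obtain A B where "set_mset A \<subseteq> N" "set_mset B \<subseteq> N" "x = val A" "y = val B"
    by (auto simp: S_eq)
  then show ?thesis using val_in_S[of "A + B"] by simp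
qed

lemma S_nonneg: "x \<in> S \<Longrightarrow> x \<ge> 0"
  by (auto simp: S_eq val_nonneg)

lemma multiple_in_S: "i \<in> N \<Longrightarrow> of_nat q * r ^ i \<in> S"
  using val_in_S[of "replicate_mset q i"] by (auto split: if_splits)

lemma munits_S: "munits S = {0}"
proof -
  have "u = 0" if "u \<in> S" "v \<in> S" "u + v = 0" for u v
    using S_nonneg[of u] S_nonneg[of v] that by linarith
  then show ?thesis
    using exp_puiseux.zero[of r N] by (auto simp: munits_def intro!: bexI[of _ 0])
qed

lemma mdvd_le: "mdvd S x y \<Longrightarrow> x \<le> y"
  using S_nonneg by (auto simp: mdvd_def)

lemma mdvd_add: "mdvd S x y \<Longrightarrow> c \<in> S \<Longrightarrow> mdvd S x (y + c)"
  by (auto simp: mdvd_def add.assoc intro: S_add)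

text \<open>An atom is a nonempty sum of powers, and splitting off one of them leaves a unit, that
  is 0. Equality can fail: for integers r > 1 only 1 is an atom.\<close>

lemma atoms_subset: "atoms S \<subseteq> (\<lambda>i. r ^ i) ` N"
proof
  fix a assume a: "a \<in> atoms S"
  then obtain A where A: "set_mset A \<subseteq> N" "a = val A"
    by (auto simp: atoms_def S_eq)
  have "a \<noteq> 0" using a munits_S by (auto simp: atoms_def)
  then obtain i B where B: "A = add_mset i B"
    using A by (metis multiset_cases val_empty)
  have iB: "i \<in> N" "set_mset B \<subseteq> N" using A B by auto
  have "r ^ i \<in> S" using multiple_in_S[OF iB(1), of 1] by simp
  then have "r ^ i = 0 \<or> val B = 0"
    using a A B val_in_S[OF iB(2)] munits_S by (auto simp: atoms_def)
  then show "a \<in> (\<lambda>i. r ^ i) ` N"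
    using r_pos A B iB by auto
qed

lemma factorization_index:
  assumes "z \<in> factorizations S"
  obtains A where "set_mset A \<subseteq> N" "z = image_mset (\<lambda>i. r ^ i) A"
proof -
  have "\<exists>A. set_mset A \<subseteq> N \<and> z = image_mset (\<lambda>i. r ^ i) A"
    using assms
  proof (induction z)
    case (add a z)
    then obtain A where A: "set_mset A \<subseteq> N" "z = image_mset (\<lambda>i. r ^ i) A"
      by (auto simp: factorizations_def)
    from add.prems obtain i where "i \<in> N" "a = r ^ i"
      using atoms_subset by (auto simp: factorizations_def)
    with A show ?case by (intro exI[of _ "add_mset i A"]) auto
  qed auto
  then show ?thesis using that by blast
qed

section \<open>The chain condition on principal ideals\<close>

lemma accp_if_ge_one:
  assumes "r \<ge> 1"
  shows "accp S"
  unfolding accp_def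
proof (intro allI impI, elim conjE)
  fix f assume f: "\<forall>k. f k \<in> S" and dv: "\<forall>k. mdvd S (f (Suc k)) (f k)"
  have ge_one: "c = 0 \<or> c \<ge> 1" if "c \<in> S" for c
    using that
  proof induction
    case (step x k)
    then show ?case
      using S_nonneg[of x] one_le_power[OF assms, of k] by (auto simp: add_increasing)
  qed auto
  \<comment> \<open>Each strict step lowers the value by at least 1, which nonnegative values allow
    only finitely often.\<close>
  have decr: "f (Suc k) = f k \<or> f (Suc k) \<le> f k - 1" for k
  proof -
    obtain c where "c \<in> S" "f k = f (Suc k) + c"
      using dv unfolding mdvd_def by blast
    then show ?thesis using ge_one[of c] by auto
  qed
  show "\<exists>k0. \<forall>k\<ge>k0. mdvd S (f k) (f (Suc k))"
  proof (rule ccontr)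
    assume "\<not> ?thesis"
    then have inf: "\<exists>k\<ge>k0. f (Suc k) \<noteq> f k" for k0
      by (metis add.right_neutral exp_puiseux.zero mdvd_def)
    have mono: "f l \<le> f k" if "k \<le> l" for k l
      using that
    proof (induction rule: dec_induct)
      case (step l)
      then show ?case using decr[of l] by linarith
    qed simp
    have "\<exists>k. f k \<le> f 0 - of_nat q" for q
    proof (induction q)
      case (Suc q)
      then obtain k where k: "f k \<le> f 0 - of_nat q" by blast
      obtain l where "l \<ge> k" "f (Suc l) \<noteq> f l" using inf by blast
      then have "f (Suc l) \<le> f k - 1" using decr[of l] mono[of k l] by linarith
      with k have "f (Suc l) \<le> f 0 - of_nat (Suc q)" by simp
      then show ?case by blast
    qed auto
    moreover obtain q where "f 0 < of_nat q" using reals_Archimedean2 by blast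
    ultimately obtain k where "f k < 0" by (metis diff_less_0_iff_less order_le_less_trans)
    then show False using f S_nonneg[of "f k"] by force
  qed
qed

lemma not_accp_if_less_one:
  assumes "r < 1"
  shows "\<not> accp S"
proof
  assume accp: "accp S"
  obtain K where K: "\<And>j. j \<ge> K \<Longrightarrow> j \<in> N" using conductor by blast
  have nd: "n < d" using assms d_pos by (simp add: r_def)
  \<comment> \<open>Trading \<open>n\<close> copies for \<open>d\<close> copies one exponent higher
    and discarding \<open>d - n\<close> of them gives the next term; the shift by \<open>K\<close>
    keeps all exponents in \<open>N\<close>.\<close>
  define f where "f k = of_nat n * r ^ (K + k)" for k
  have "f k = f (Suc k) + of_nat (d - n) * r ^ (K + Suc k)" for k
    using r_power_mult[of "K + k"] nd by (auto simp: f_def of_nat_diff algebra_simps)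
  moreover have "of_nat (d - n) * r ^ (K + Suc k) \<in> S" for k
    by (intro multiple_in_S K) simp
  ultimately have "mdvd S (f (Suc k)) (f k)" for k
    unfolding mdvd_def by blast
  moreover have "f k \<in> S" for k unfolding f_def by (intro multiple_in_S K) simp
  ultimately obtain k where "mdvd S (f k) (f (Suc k))"
    using accp unfolding accp_def by (meson order_refl)
  then have "f k \<le> f (Suc k)" by (rule mdvd_le)
  moreover have "f (Suc k) < f k"
    using assms r_pos n_pos by (simp add: f_def)
  ultimately show False by simp
qed

subsection \<open>Omega for r at least 1\<close>

lemma supported_add_iff [simp]:
  "supported j (A + B) \<longleftrightarrow> supported j A \<and> supported j B"
  by (auto simp: supported_def)

lemma supported_imp_subset: "supported j A \<Longrightarrow> set_mset A \<subseteq> N"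
  by (auto simp: supported_def)

lemma ex_supported:
  assumes "set_mset A \<subseteq> N"
  obtains j where "j \<ge> k" "supported j A"
proof -
  obtain j where "\<forall>i \<in> set_mset A. i \<le> j"
    using finite_nat_set_iff_bounded_le[of "set_mset A"] by auto
  then have "supported (max j k) A" using assms by (auto simp: supported_def le_max_iff_disj)
  then show ?thesis using that[of "max j k"] by simp
qed

lemma split_top:
  assumes "supported (Suc j) A"
  obtains A' where "A = replicate_mset (count A (Suc j)) (Suc j) + A'" "supported j A'"
proof
  show "A = replicate_mset (count A (Suc j)) (Suc j) + filter_mset (\<lambda>i. i \<noteq> Suc j) A"
    by (intro multiset_eqI) auto
  show "supported j (filter_mset (\<lambda>i. i \<noteq> Suc j) A)"
    using assms by (auto simp: supported_def le_Suc_eq)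
qed

lemma val_denominator:
  assumes "supported j A"
  shows "val A * of_nat d ^ j \<in> \<int>"
  using assms
proof (induction A)
  case (add i A)
  then have "i \<le> j" and A: "supported j A" by (auto simp: supported_def)
  then have "r ^ i * of_nat d ^ j = (r ^ i * of_nat d ^ i) * of_nat d ^ (j - i)"
    by (simp add: power_add[symmetric])
  then have "r ^ i * of_nat d ^ j \<in> \<int>" by (simp add: r_power_d)
  with add.IH[OF A] show ?case by (simp add: distrib_right)
qed simp

text \<open>After one further factor \<open>d\<close>, the hypothesis says that \<open>d\<close>
  divides \<open>c * n ^ Suc j\<close>, and \<open>n\<close> is coprime to \<open>d\<close>.\<close>

lemma top_coefficient_divisible:
  assumes "of_int c * r ^ Suc j * of_nat d ^ j \<in> \<int>"
  shows "int d dvd c"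
proof -
  from assms obtain m where m: "of_int c * r ^ Suc j * of_nat d ^ j = (of_int m :: rat)"
    by (auto elim: Ints_cases)
  have "of_int c * of_nat n ^ Suc j = of_int c * r ^ Suc j * of_nat d ^ Suc j"
    by (metis mult.assoc r_power_d)
  also have "\<dots> = of_int m * of_nat d" using m by simp
  finally have "of_int (c * int n ^ Suc j) = (of_int (m * int d) :: rat)" by simp
  then have "c * int n ^ Suc j = m * int d" by (simp only: of_int_eq_iff)
  then have "int d dvd c * int n ^ Suc j" by simp
  moreover have "coprime (int d) (int n ^ Suc j)"
    using coprime by (simp add: coprime_commute)
  ultimately show ?thesis by (simp add: coprime_dvd_mult_left_iff)
qed

text \<open>Powers of r beyond the denominator of an element occur in multiples of d and can be
  traded downwards.\<close>

lemma lower_support: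
  assumes "\<And>i. i \<ge> j \<Longrightarrow> i \<in> N" "j \<le> J" "supported J A" "val A * of_nat d ^ j \<in> \<int>"
  obtains B where "supported j B" "val B = val A"
proof -
  have "\<exists>B. supported j B \<and> val B = val A"
    using assms(2,3,4)
  proof (induction J arbitrary: A rule: dec_induct)
    case (step J)
    from split_top[OF step.prems(1)] obtain A' where
      A: "A = replicate_mset (count A (Suc J)) (Suc J) + A'" and A': "supported J A'" by blast
    define c where "c = count A (Suc J)"
    have v: "val A = of_nat c * r ^ Suc J + val A'"
      using arg_cong[OF A, of val] by (simp only: val_union val_replicate c_def)
    have "val A * of_nat d ^ J = val A * of_nat d ^ j * of_nat d ^ (J - j)"
      using step.hyps by (simp add: power_add[symmetric])
    moreover have "val A * of_nat d ^ j * of_nat d ^ (J - j) \<in> \<int>"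
      by (rule Ints_mult[OF step.prems(2)]) simp
    ultimately have "val A * of_nat d ^ J \<in> \<int>" by (simp only:)
    \<comment> \<open>Both \<open>val A\<close> and \<open>val A'\<close> have denominators dividing
      \<open>d ^ J\<close>, hence so does the top term, which forces \<open>d\<close> to divide its
      multiplicity.\<close>
    then have "val A * of_nat d ^ J - val A' * of_nat d ^ J \<in> \<int>"
      using val_denominator[OF A'] by (rule Ints_diff)
    then have "of_int (int c) * r ^ Suc J * of_nat d ^ J \<in> \<int>"
      by (simp add: v algebra_simps)
    then have "int d dvd int c" by (rule top_coefficient_divisible)
    then obtain q where q: "c = d * q" by auto
    define B where "B = replicate_mset (n * q) J + A'"
    have "val B = val A"
      using r_power_mult[of J] by (simp add: B_def v q algebra_simps del: power_Suc)
    moreover have "supported J B"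
      using A' assms(1)[of J] step.hyps by (auto simp: B_def supported_def)
    ultimately show ?case using step.IH[of B] step.prems(2) by auto
  qed auto
  then show ?thesis using that by blast
qed

text \<open>The cofactor can be rewritten with exponents at most \<open>Suc j\<close>. Comparing
  denominators, its multiplicity of \<open>Suc j\<close> is congruent to \<open>s\<close> modulo
  \<open>d\<close>; as \<open>s < d\<close>, it contains at least \<open>s\<close> copies of the top
  power, which cancel on both sides.\<close>

lemma drop_top_remainder:
  assumes N: "\<And>i. i \<ge> j \<Longrightarrow> i \<in> N" and "k \<in> N" "k \<le> j" "s < d" and Y: "supported j Y"
    and dv: "mdvd S (r ^ k) (of_nat s * r ^ Suc j + val Y)"
  shows "mdvd S (r ^ k) (val Y)"
proof -
  obtain C where C: "set_mset C \<subseteq> N" "of_nat s * r ^ Suc j + val Y = r ^ k + val C"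
    using dv by (auto simp: mdvd_def S_eq)
  obtain J where J: "J \<ge> Suc j" "supported J C" using ex_supported[OF C(1)] by blast
  have k: "supported j {#k#}" using assms by (simp add: supported_def)
  have kY: "(val Y - r ^ k) * of_nat d ^ j \<in> \<int>"
    using Ints_diff[OF val_denominator[OF Y] val_denominator[OF k]] by (simp add: algebra_simps)
  have "supported (Suc j) (replicate_mset s (Suc j) + Y)"
    using Y N[of "Suc j"] by (auto simp: supported_def split: if_splits)
  moreover have "supported (Suc j) {#k#}" using assms by (simp add: supported_def)
  ultimately have "val (replicate_mset s (Suc j) + Y) * of_nat d ^ Suc j
      - val {#k#} * of_nat d ^ Suc j \<in> \<int>"
    by (intro Ints_diff val_denominator)
  also have "val (replicate_mset s (Suc j) + Y) * of_nat d ^ Suc j - val {#k#} * of_nat d ^ Suc j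
      = (of_nat s * r ^ Suc j + val Y - r ^ k) * of_nat d ^ Suc j"
    by (simp add: left_diff_distrib del: power_Suc)
  also have "\<dots> = val C * of_nat d ^ Suc j" using C(2) by simp
  finally have "val C * of_nat d ^ Suc j \<in> \<int>" .
  then obtain B where B: "supported (Suc j) B" "val B = val C"
    using lower_support[OF _ J] N by (metis Suc_leD)
  from split_top[OF B(1)] obtain B' where
    B': "B = replicate_mset (count B (Suc j)) (Suc j) + B'" "supported j B'" by blast
  define c where "c = count B (Suc j)"
  have v: "val C = of_nat c * r ^ Suc j + val B'"
    using arg_cong[OF B'(1), of val] B(2) by (simp only: val_union val_replicate c_def)
  have eq: "of_int (int c - int s) * r ^ Suc j = (val Y - r ^ k) - val B'"
    using C(2) v by (simp add: algebra_simps)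
  have "of_int (int c - int s) * r ^ Suc j * of_nat d ^ j \<in> \<int>"
    unfolding eq left_diff_distrib[of _ "val B'"] by (intro Ints_diff kY val_denominator B')
  then have "int d dvd int c - int s" by (rule top_coefficient_divisible)
  then obtain e where e: "int c - int s = int d * e" by auto
  have "e \<ge> 0"
  proof (rule ccontr)
    assume "\<not> e \<ge> 0"
    then have "int d * e \<le> int d * (-1)" by (intro mult_left_mono) auto
    then show False using e \<open>s < d\<close> by linarith
  qed
  then have "int d * e \<ge> 0" by simp
  then have "s \<le> c" using e by linarith
  then have "val Y = r ^ k + (of_nat (c - s) * r ^ Suc j + val B')"
    using eq by (simp add: of_nat_diff)
  moreover have "of_nat (c - s) * r ^ Suc j + val B' \<in> S"
    using N[of "Suc j"] by (intro S_add multiple_in_S val_in_S supported_imp_subset[OF B'(2)]) auto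
  ultimately show ?thesis unfolding mdvd_def by blast
qed

section \<open>Large multiples divisible by a fixed power of r\<close>

context
  fixes k m :: nat
  assumes k: "k \<in> N" "k \<le> m" and m: "\<And>j. j \<ge> m \<Longrightarrow> j \<in> N"
begin

lemma mdvd_multiple_low:
  assumes "i \<le> m"
  shows "mdvd S (r ^ k) (of_nat ((n * d) ^ m) * r ^ i)"
proof -
  \<comment> \<open>\<open>q\<close> solves \<open>(n * d) ^ m * r ^ i = q * r ^ k\<close>; the
    subtractions are exact because \<open>k\<close> and \<open>i\<close> are at most
    \<open>m\<close>.\<close>
  define q where "q = n ^ (m - k + i) * d ^ (m + k - i)"
  have "q > 0" using n_pos d_pos by (simp add: q_def)
  have q: "of_nat q * r ^ k * of_nat d ^ (k + i) = of_nat n ^ (m + i) * of_nat d ^ (m + k)"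
  proof -
    have "of_nat q * r ^ k * of_nat d ^ (k + i)
        = (r ^ k * of_nat d ^ k) * of_nat n ^ (m - k + i) * (of_nat d ^ (m + k - i) * of_nat d ^ i)"
      by (simp add: q_def power_add)
    also have "\<dots> = of_nat n ^ (k + (m - k + i)) * of_nat d ^ (m + k - i + i)"
      by (simp only: r_power_d power_add)
    finally show ?thesis using k assms by simp
  qed
  have i: "of_nat ((n * d) ^ m) * r ^ i * of_nat d ^ (k + i)
      = (of_nat n ^ (m + i) * of_nat d ^ (m + k) :: rat)"
  proof -
    have "of_nat ((n * d) ^ m) * r ^ i * of_nat d ^ (k + i)
        = (r ^ i * of_nat d ^ i) * of_nat n ^ m * (of_nat d ^ m * of_nat d ^ k)"
      by (simp add: power_add power_mult_distrib)
    then show ?thesis by (simp only: r_power_d power_add mult.assoc mult.commute mult.left_commute)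
  qed
  have "(of_nat d :: rat) ^ (k + i) \<noteq> 0" using d_pos by simp
  then have "of_nat ((n * d) ^ m) * r ^ i = of_nat q * r ^ k"
    by (rule mult_right_cancel[THEN iffD1]) (simp only: q i)
  also have "\<dots> = r ^ k + of_nat (q - 1) * r ^ k"
    using \<open>q > 0\<close> by (simp add: of_nat_diff algebra_simps)
  finally show ?thesis
    using multiple_in_S[OF k(1)] unfolding mdvd_def by blast
qed

context
  assumes ge_one: "d \<le> n"
begin

text \<open>The extra factor \<open>d\<close> supplies whole blocks to trade: \<open>d * D\<close>
  copies become \<open>n * D\<close> copies one exponent lower, of which \<open>d * D\<close> are
  kept since \<open>d \<le> n\<close>. Hence the threshold does not depend on
  \<open>j\<close>.\<close>

lemma mdvd_multiple_high:
  assumes "m \<le> j" "q \<ge> d * (n * d) ^ m"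
  shows "mdvd S (r ^ k) (of_nat q * r ^ j)"
proof -
  define D where "D = (n * d) ^ m"
  have "mdvd S (r ^ k) (of_nat (d * D) * r ^ j)"
    using assms(1)
  proof (induction rule: dec_induct)
    case base
    have "of_nat (d * D) * r ^ m = of_nat D * r ^ m + of_nat ((d - 1) * D) * r ^ m"
      using d_pos by (simp add: of_nat_diff algebra_simps)
    moreover have "mdvd S (r ^ k) (of_nat D * r ^ m)"
      unfolding D_def by (rule mdvd_multiple_low) simp
    ultimately show ?case
      using mdvd_add[OF _ multiple_in_S[OF m[OF order_refl]]] by (simp only:)
  next
    case (step j)
    have "of_nat (d * D) * r ^ Suc j = of_nat D * (of_nat d * r ^ Suc j)"
      by (simp del: power_Suc)
    also have "\<dots> = of_nat (d * D) * r ^ j + of_nat ((n - d) * D) * r ^ j"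
      unfolding r_power_mult using ge_one by (simp add: of_nat_diff algebra_simps)
    finally show ?case
      using mdvd_add[OF step.IH multiple_in_S[OF m]] step.hyps by (simp only:)
  qed
  moreover have "of_nat q * r ^ j = of_nat (d * D) * r ^ j + of_nat (q - d * D) * r ^ j"
    using assms(2) by (simp add: D_def of_nat_diff algebra_simps)
  ultimately show ?thesis
    using mdvd_add[OF _ multiple_in_S[OF m[OF assms(1)]]] by (simp only:)
qed

text \<open>Scanning a factorization from the top, \<open>t\<close> counts the blocks of d equal powers collected
  so far: each block trades for n at least d copies of the next lower power, so \<open>t\<close> never
  decreases, and it only costs further atoms when it grows.\<close>

lemma bounded_divisible_subsum:
  assumes "m \<le> j" "supported j z" "mdvd S (r ^ k) (of_nat (n * t) * r ^ j + val z)"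
  shows "\<exists>w. w \<subseteq># z \<and> size w \<le> d * ((n * d) ^ m - t) + (n * d) ^ m * Suc m \<and>
    mdvd S (r ^ k) (of_nat (n * t) * r ^ j + val w)"
  using assms
proof (induction j arbitrary: z t rule: dec_induct)
  case base
  define D where "D = (n * d) ^ m"
  show ?case
  \<comment> \<open>Either some exponent occurs \<open>D\<close> times and those copies suffice, or
    all multiplicities are below \<open>D\<close> and \<open>z\<close> itself is small
    enough.\<close>
  proof (cases "\<exists>i. count z i \<ge> D")
    case True
    then obtain i where i: "count z i \<ge> D" by blast
    have "D > 0" using n_pos d_pos by (simp add: D_def)
    with i have "i \<in># z" by (metis count_greater_zero_iff order_less_le_trans)
    then have "i \<le> m" "i \<in> N" using base by (auto simp: supported_def)
    have "mdvd S (r ^ k) (val (replicate_mset D i) + of_nat (n * t) * r ^ m)"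
      unfolding D_def val_replicate
      by (intro mdvd_add mdvd_multiple_low multiple_in_S m order_refl \<open>i \<le> m\<close>)
    moreover have "replicate_mset D i \<subseteq># z"
      using i by (simp add: count_le_replicate_mset_subset_eq)
    ultimately show ?thesis
      by (intro exI[of _ "replicate_mset D i"]) (auto simp: D_def add.commute)
  next
    case False
    have "size z = (\<Sum>i\<in>set_mset z. count z i)" by (rule size_multiset_overloaded_eq)
    also have "\<dots> \<le> (\<Sum>i\<in>set_mset z. D)"
      using False by (intro sum_mono) (meson nle_le)
    also have "\<dots> \<le> Suc m * D"
    proof -
      have "card (set_mset z) \<le> Suc m"
        using card_mono[of "{..m}" "set_mset z"] base by (auto simp: supported_def)
      then show ?thesis by (simp only: sum_constant of_nat_id mult_le_mono1)
    qed
    finally have "size z \<le> D * Suc m" by (simp only: mult.commute)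
    with base show ?thesis by (intro exI[of _ z]) (simp add: D_def trans_le_add2)
  qed
next
  case (step j)
  define D where "D = (n * d) ^ m"
  define c where "c = count z (Suc j)"
  \<comment> \<open>The \<open>n * t\<close> carried copies and the \<open>c\<close> copies in
    \<open>z\<close> form \<open>t'\<close> full blocks of \<open>d\<close>; the remainder
    \<open>s\<close> is disposed of by \<open>drop_top_remainder\<close>.\<close>
  define t' where "t' = (n * t + c) div d"
  define s where "s = (n * t + c) mod d"
  obtain z' where z: "z = replicate_mset c (Suc j) + z'" and z': "supported j z'"
    using split_top[OF step.prems(1)] unfolding c_def by blast
  have ts: "n * t + c = d * t' + s" by (simp add: t'_def s_def)
  have ntd: "d * t \<le> n * t" using ge_one by simp
  show ?case
  proof (cases "t' \<ge> D")
    case True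
    \<comment> \<open>Tops the carried copies up to \<open>d * D\<close>; truncated subtraction
      gives 0 if they already suffice.\<close>
    define v where "v = d * D - n * t"
    have "d * D \<le> d * t'" using True by simp
    then have "v \<le> c" using ts unfolding v_def by linarith
    have "mdvd S (r ^ k) (of_nat (n * t + v) * r ^ Suc j)"
      by (rule mdvd_multiple_high) (use step.hyps in \<open>auto simp: v_def D_def\<close>)
    then have "mdvd S (r ^ k) (of_nat (n * t) * r ^ Suc j + val (replicate_mset v (Suc j)))"
      by (simp add: distrib_right del: power_Suc)
    moreover have "v \<le> d * (D - t)"
      unfolding v_def diff_mult_distrib2 using ntd by (rule diff_le_mono2)
    moreover have "replicate_mset v (Suc j) \<subseteq># z"
      using \<open>v \<le> c\<close> by (simp add: count_le_replicate_mset_subset_eq c_def)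
    ultimately show ?thesis
      by (intro exI[of _ "replicate_mset v (Suc j)"]) (auto simp: D_def)
  next
    case False
    have "d * t < d * t' + d"
    proof -
      have "s < d" using d_pos by (simp add: s_def)
      then show ?thesis using ts ntd by linarith
    qed
    then have "t \<le> t'"
      by (metis less_Suc_eq_le mult_Suc_right mult_less_cancel1 add.commute)
    \<comment> \<open>The atoms spent to complete \<open>t'\<close> blocks. If the carried copies
      alone exceed \<open>d * t'\<close>, this is 0, and the surplus
      \<open>n * t + v - d * t'\<close> survives below as a harmless summand.\<close>
    define v where "v = d * t' - n * t"
    have "v \<le> c" using ts unfolding v_def by linarith
    have trade: "of_nat (d * t') * r ^ Suc j = of_nat (n * t') * r ^ j"
      using r_power_mult[of j] by (simp add: algebra_simps del: power_Suc)
    define Y where "Y = replicate_mset (n * t') j + z'"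
    have "supported j Y"
      using z' m step.hyps by (auto simp: Y_def supported_def split: if_splits)
    moreover have "of_nat (n * t) * r ^ Suc j + val z = of_nat s * r ^ Suc j + val Y"
    proof -
      have "of_nat (n * t) * r ^ Suc j + val z = of_nat (n * t + c) * r ^ Suc j + val z'"
        by (simp add: z distrib_right del: power_Suc)
      also have "\<dots> = of_nat s * r ^ Suc j + (of_nat (d * t') * r ^ Suc j + val z')"
        unfolding ts by (simp add: distrib_right del: power_Suc)
      finally show ?thesis unfolding trade by (simp add: Y_def)
    qed
    moreover have "s < d" using d_pos by (simp add: s_def)
    ultimately have "mdvd S (r ^ k) (val Y)"
      using step.prems(2) step.hyps k m
      by (intro drop_top_remainder[of j k s Y]) auto
    then obtain w where w: "w \<subseteq># z'" "size w \<le> d * (D - t') + D * Suc m"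
      and dvd: "mdvd S (r ^ k) (of_nat (n * t') * r ^ j + val w)"
      using step.IH[OF z', of t'] by (auto simp: Y_def D_def)
    define w' where "w' = replicate_mset v (Suc j) + w"
    have "of_nat (n * t) * r ^ Suc j + val w' = of_nat (n * t + v) * r ^ Suc j + val w"
      by (simp add: w'_def distrib_right del: power_Suc)
    also have "n * t + v = d * t' + (n * t + v - d * t')" by (simp add: v_def)
    also have "of_nat \<dots> * r ^ Suc j + val w
        = (of_nat (n * t') * r ^ j + val w) + of_nat (n * t + v - d * t') * r ^ Suc j"
      unfolding of_nat_add distrib_right trade by simp
    finally have "mdvd S (r ^ k) (of_nat (n * t) * r ^ Suc j + val w')"
      using mdvd_add[OF dvd multiple_in_S[OF m[of "Suc j"]]] step.hyps by (simp del: power_Suc)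
    moreover have "w' \<subseteq># z"
      unfolding w'_def z using \<open>v \<le> c\<close> w(1)
      by (intro subset_mset.add_mono) (simp_all add: count_le_replicate_mset_subset_eq[symmetric])
    moreover have "size w' \<le> d * (D - t) + D * Suc m"
    proof -
      \<comment> \<open>Since \<open>d * t \<le> n * t\<close>, the cost is bounded by the growth of
        the block count, so the costs telescope along the scan.\<close>
      have "v \<le> d * (t' - t)"
        unfolding v_def diff_mult_distrib2 using ntd by (rule diff_le_mono2)
      moreover have "d * (t' - t) + d * (D - t') = d * (D - t)"
        using \<open>t \<le> t'\<close> False by (simp add: distrib_left[symmetric])
      ultimately show ?thesis using w(2) by (simp add: w'_def)
    qed
    ultimately show ?thesis unfolding D_def by blast
  qed
qed

end

end

lemma sum_mset_image_power: "sum_mset (image_mset (\<lambda>i. r ^ i) A) = val A"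
  by (simp add: val_def)

lemma omega_finite_if_ge_one:
  assumes "r \<ge> 1" "a \<in> atoms S"
  shows "omega S a < \<infinity>"
proof -
  have ge: "d \<le> n" using assms(1) d_pos by (simp add: r_def)
  obtain k where k: "k \<in> N" "a = r ^ k" using assms(2) atoms_subset by blast
  obtain K where K: "\<And>j. j \<ge> K \<Longrightarrow> j \<in> N" using conductor by blast
  define m where "m = max k K"
  have m: "k \<le> m" "\<And>j. j \<ge> m \<Longrightarrow> j \<in> N" using K by (auto simp: m_def)
  have "\<exists>w. w \<subseteq># z \<and> size w \<le> d * (n * d) ^ m + (n * d) ^ m * Suc m \<and> mdvd S a (sum_mset w)"
    if z: "z \<in> factorizations S" "mdvd S a (sum_mset z)" for z
  proof -
    obtain A where A: "set_mset A \<subseteq> N" "z = image_mset (\<lambda>i. r ^ i) A"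
      using factorization_index[OF z(1)] .
    obtain j where j: "j \<ge> m" "supported j A" using ex_supported[OF A(1)] .
    \<comment> \<open>The scan starts with \<open>t = 0\<close>, and the resulting bound is
      independent of \<open>j\<close>, hence of the factorization.\<close>
    have "mdvd S (r ^ k) (of_nat (n * 0) * r ^ j + val A)"
      using z A k by (simp add: sum_mset_image_power)
    from bounded_divisible_subsum[OF k(1) m ge j this] obtain w where
      "w \<subseteq># A" "size w \<le> d * (n * d) ^ m + (n * d) ^ m * Suc m" "mdvd S (r ^ k) (val w)"
      by auto
    then show ?thesis
      using A k by (intro exI[of _ "image_mset (\<lambda>i. r ^ i) w"])
        (auto simp: sum_mset_image_power image_mset_subseteq_mono)
  qed
  then show ?thesis unfolding omega_finite_iff by blast
qed

subsection \<open>The case r less than 1\<close>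

text \<open>If \<open>n = 1\<close>, every power is a sum of several copies of a higher power with
  exponent in \<open>N\<close>, so no power is an atom, although 1 must factor.\<close>

lemma one_less_n_if_atomic:
  assumes "r < 1" "atomic S"
  shows "n > 1"
proof (rule ccontr)
  assume "\<not> n > 1"
  then have n: "n = 1" using n_pos by simp
  then have "d > 1" using assms(1) d_pos by (simp add: r_def)
  have "1 \<in> S" using multiple_in_S[OF zero_in_N, of 1] by simp
  then obtain z where z: "z \<in> factorizations S" "sum_mset z = 1"
    using assms(2) munits_S by (auto simp: atomic_def)
  then have "z \<noteq> {#}" by auto
  then obtain a where "a \<in> atoms S" using z(1) by (auto simp: factorizations_def)
  then obtain k where k: "k \<in> N" "r ^ k \<in> atoms S" using atoms_subset by blast
  obtain K where K: "\<And>j. j \<ge> K \<Longrightarrow> j \<in> N" using conductor by blast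
  define l where "l = k + Suc K"
  define q where "q = d ^ Suc K"
  have "l \<in> N" using K by (simp add: l_def)
  have "q > 1" unfolding q_def using \<open>d > 1\<close> by (rule one_less_power) simp
  have "r ^ k = of_nat q * r ^ l"
    using r_power_d[of "Suc K"] by (simp add: l_def q_def power_add n mult.commute mult.left_commute)
  also have "\<dots> = of_nat 1 * r ^ l + of_nat (q - 1) * r ^ l"
    using \<open>q > 1\<close> by (simp add: of_nat_diff algebra_simps)
  finally have "of_nat 1 * r ^ l = 0 \<or> of_nat (q - 1) * r ^ l = 0"
    using k(2) multiple_in_S[OF \<open>l \<in> N\<close>] munits_S unfolding atoms_def by blast
  then show False using r_pos \<open>q > 1\<close> by auto
qed

text \<open>Counterpart of \<open>val_denominator\<close>: a factor \<open>r ^ l\<close> remains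
  after clearing denominators, which exposes divisibility by powers of \<open>n\<close>.\<close>

lemma val_numerator:
  assumes "\<forall>i \<in># A. l \<le> i"
  shows "\<exists>J m. val A * of_nat d ^ J = r ^ l * of_nat m"
  using assms
proof (induction A)
  case empty
  then show ?case by (intro exI[of _ 0]) simp
next
  case (add i A)
  then obtain J m where Jm: "val A * of_nat d ^ J = r ^ l * of_nat m" by auto
  define e where "e = i - l"
  have i: "i = l + e" using add.prems by (simp add: e_def)
  have "val (add_mset i A) * of_nat d ^ (J + e)
      = r ^ l * ((r ^ e * of_nat d ^ e) * of_nat d ^ J) + (val A * of_nat d ^ J) * of_nat d ^ e"
    by (simp add: i power_add algebra_simps)
  also have "\<dots> = r ^ l * of_nat (n ^ e * d ^ J + m * d ^ e)"
    unfolding Jm r_power_d by (simp add: algebra_simps)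
  finally show ?case by blast
qed

section \<open>Trades between consecutive exponents in \<open>N\<close>\<close>

definition gap :: "nat \<Rightarrow> nat" where
  "gap i = (LEAST g. g > 0 \<and> i + g \<in> N)"

lemma gap_pos: "gap i > 0" and add_gap_in: "i + gap i \<in> N"
proof -
  obtain K where "\<And>j. j \<ge> K \<Longrightarrow> j \<in> N" using conductor by blast
  then have "Suc K > 0 \<and> i + Suc K \<in> N" by simp
  then have "gap i > 0 \<and> i + gap i \<in> N" unfolding gap_def by (rule LeastI)
  then show "gap i > 0" "i + gap i \<in> N" by auto
qed

lemma add_gap_le:
  assumes "j \<in> N" "i < j"
  shows "i + gap i \<le> j"
proof -
  have "gap i \<le> j - i" unfolding gap_def using assms by (intro Least_le) auto
  then show ?thesis using assms by simp
qed

lemma trade_power: "of_nat (d ^ g) * r ^ (i + g) = of_nat (n ^ g) * r ^ i"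
  using r_power_d[of g] by (simp add: power_add mult.commute mult.left_commute)

text \<open>Terms below \<open>i\<close> cancel, and the exponents above \<open>i\<close> start at
  \<open>i + gap i\<close>. So the difference at \<open>i\<close>, times a power of
  \<open>d\<close>, is a multiple of \<open>n ^ gap i\<close>, and coprimality removes the power of
  \<open>d\<close>.\<close>

lemma lowest_difference_divisible:
  assumes "set_mset A \<subseteq> N" "set_mset B \<subseteq> N" "val A = val B" "\<forall>l < i. count A l = count B l"
  shows "int (n ^ gap i) dvd int (count A i) - int (count B i)"
proof -
  define g where "g = gap i"
  have high: "\<forall>j \<in># filter_mset (\<lambda>j. i < j) C. i + g \<le> j" if "set_mset C \<subseteq> N" for C
    using that add_gap_le by (auto simp: g_def)
  define a b HA HB where "a = count A i" "b = count B i"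
    "HA = filter_mset (\<lambda>j. i < j) A" "HB = filter_mset (\<lambda>j. i < j) B"
  obtain J1 m1 where 1: "val HA * of_nat d ^ J1 = r ^ (i + g) * of_nat m1"
    using val_numerator[OF high[OF assms(1)]] a_b_HA_HB_def by auto
  obtain J2 m2 where 2: "val HB * of_nat d ^ J2 = r ^ (i + g) * of_nat m2"
    using val_numerator[OF high[OF assms(2)]] a_b_HA_HB_def by auto
  have "val A = val (filter_mset (\<lambda>j. j < i) A) + of_nat a * r ^ i + val HA"
    using arg_cong[OF split_at[of A i], of val]
    by (simp only: val_union val_replicate a_b_HA_HB_def)
  moreover have "val B = val (filter_mset (\<lambda>j. j < i) A) + of_nat b * r ^ i + val HB"
    using arg_cong[OF split_at[of B i], of val] filter_less_cong[OF assms(4)]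
    by (simp only: val_union val_replicate a_b_HA_HB_def)
  ultimately have diff: "(of_nat a - of_nat b) * r ^ i = val HB - val HA"
    using assms(3) by (simp add: algebra_simps)
  have "(of_nat a - of_nat b) * r ^ i * of_nat d ^ (J1 + J2)
      = (val HB * of_nat d ^ J2) * of_nat d ^ J1 - (val HA * of_nat d ^ J1) * of_nat d ^ J2"
    unfolding diff by (simp add: power_add algebra_simps)
  also have "\<dots> = r ^ i * (r ^ g * (of_nat m2 * of_nat d ^ J1 - of_nat m1 * of_nat d ^ J2))"
    unfolding 1 2 by (simp add: power_add algebra_simps)
  finally have "(of_nat a - of_nat b) * of_nat d ^ (J1 + J2)
      = r ^ g * (of_nat m2 * of_nat d ^ J1 - of_nat m1 * of_nat d ^ J2)"
    using r_pos by (simp add: mult.commute mult.left_commute)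
  then have "(of_nat a - of_nat b) * of_nat d ^ (J1 + J2) * of_nat d ^ g
      = (r ^ g * of_nat d ^ g) * (of_nat m2 * of_nat d ^ J1 - of_nat m1 * of_nat d ^ J2)"
    by (simp add: mult.commute mult.left_commute)
  then have "of_int ((int a - int b) * int d ^ (J1 + J2 + g))
      = (of_int (int n ^ g * (int m2 * int d ^ J1 - int m1 * int d ^ J2)) :: rat)"
    unfolding r_power_d by (simp add: power_add mult.assoc)
  then have "(int a - int b) * int d ^ (J1 + J2 + g)
      = int n ^ g * (int m2 * int d ^ J1 - int m1 * int d ^ J2)"
    by (simp only: of_int_eq_iff)
  then have "int n ^ g dvd (int a - int b) * int d ^ (J1 + J2 + g)" by simp
  moreover have "coprime (int n ^ g) (int d ^ (J1 + J2 + g))"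
    using coprime by simp
  ultimately have "int n ^ g dvd int a - int b"
    by (simp add: coprime_dvd_mult_left_iff)
  then show ?thesis by (simp add: g_def a_b_HA_HB_def)
qed

text \<open>Two factorizations of the same element are merged by repeatedly trading at the lowest
  index where they differ.\<close>

lemma trades_generate:
  assumes refl: "\<And>A. set_mset A \<subseteq> N \<Longrightarrow> E A A"
    and sym: "\<And>A B. E A B \<Longrightarrow> E B A"
    and trans: "\<And>A B C. E A B \<Longrightarrow> E B C \<Longrightarrow> E A C"
    and trade: "\<And>i U. i \<in> N \<Longrightarrow> set_mset U \<subseteq> N \<Longrightarrow>
      E (replicate_mset (n ^ gap i) i + U) (replicate_mset (d ^ gap i) (i + gap i) + U)"
    and AB: "set_mset A \<subseteq> N" "set_mset B \<subseteq> N" "val A = val B"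
  shows "E A B"
proof -
  have trades: "E (replicate_mset (q * n ^ gap i) i + U) (replicate_mset (q * d ^ gap i) (i + gap i) + U)"
    if i: "i \<in> N" and U: "set_mset U \<subseteq> N" for i q U
    using U
  proof (induction q arbitrary: U)
    case 0
    then show ?case using refl by simp
  next
    case (Suc q)
    let ?x = "n ^ gap i" and ?y = "d ^ gap i" and ?j = "i + gap i"
    have "set_mset (replicate_mset (q * ?x) i + U) \<subseteq> N"
      using i Suc.prems by (auto split: if_splits)
    then have "E (replicate_mset ?x i + (replicate_mset (q * ?x) i + U))
        (replicate_mset ?y ?j + (replicate_mset (q * ?x) i + U))"
      by (rule trade[OF i])
    moreover have "set_mset (replicate_mset ?y ?j + U) \<subseteq> N"
      using add_gap_in Suc.prems by (auto split: if_splits)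
    then have "E (replicate_mset (q * ?x) i + (replicate_mset ?y ?j + U))
        (replicate_mset (q * ?y) ?j + (replicate_mset ?y ?j + U))"
      by (rule Suc.IH)
    ultimately show ?case
      using trans by (simp add: replicate_mset_add ac_simps)
  qed
  obtain K where K: "\<And>j. j \<ge> K \<Longrightarrow> j \<in> N" using conductor by blast
  have "set_mset (A + B) \<subseteq> N" using AB by simp
  \<comment> \<open>\<open>J \<ge> K\<close> puts \<open>J\<close> into \<open>N\<close>, so a trade
    at an exponent below \<open>J\<close> never passes \<open>J\<close>.\<close>
  then obtain J where J: "J \<ge> K" "supported J (A + B)" using ex_supported by blast
  have "J \<in> N" using K J(1) by blast
  \<comment> \<open>The induction descends from \<open>J\<close>, where equal values force equality,
    to 0, where the agreement condition is vacuous.\<close>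
  have "E A B" if "0 \<le> J" "supported J A" "supported J B" "val A = val B"
      "\<forall>l < 0. count A l = count B l" for A B
    using that
  proof (induction arbitrary: A B rule: inc_induct)
    case base
    have top: "C = filter_mset (\<lambda>j. j < J) C + replicate_mset (count C J) J"
      if "supported J C" for C
    proof -
      have "filter_mset (\<lambda>j. J < j) C = {#}"
        using that by (intro multiset_eqI) (auto simp: supported_def count_eq_zero_iff)
      then show ?thesis using split_at[of C J] by (metis add.right_neutral)
    qed
    have low: "filter_mset (\<lambda>j. j < J) A = filter_mset (\<lambda>j. j < J) B"
      by (rule filter_less_cong[OF base(4)])
    have "of_nat (count A J) * r ^ J = of_nat (count B J) * r ^ J"
      using arg_cong[OF top[OF base(1)], of val] arg_cong[OF top[OF base(2)], of val] base(3) low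
      by (simp only: val_union val_replicate)
    then have "count A J = count B J" using r_pos by simp
    then have "A = B" using top[OF base(1)] top[OF base(2)] low by metis
    then show ?case using refl base(1) supported_imp_subset by blast
  next
    case (step i)
    \<comment> \<open>By symmetry \<open>A\<close> may be taken to have at least as many copies of
      \<open>i\<close>; the excess is a multiple of \<open>n ^ gap i\<close> and is traded to the
      next exponent.\<close>
    have *: "E A B" if A: "supported J A" and B: "supported J B" and v: "val A = val B"
      and agree: "\<forall>l < i. count A l = count B l" and ge: "count B i \<le> count A i" for A B
    proof (cases "i \<in> N")
      case False
      then have "count A i = 0" "count B i = 0"
        using supported_imp_subset[OF A] supported_imp_subset[OF B]
        by (auto simp: count_eq_zero_iff)
      then show ?thesis using step.IH[OF A B v] agree by (simp add: less_Suc_eq)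
    next
      case True
      let ?x = "n ^ gap i" and ?y = "d ^ gap i" and ?j = "i + gap i"
      have "int ?x dvd int (count A i - count B i)"
        using lowest_difference_divisible[OF supported_imp_subset[OF A] supported_imp_subset[OF B] v agree] ge
        by (simp add: of_nat_diff)
      then obtain q where q: "count A i = count B i + q * ?x"
        using ge unfolding of_nat_dvd_iff by (metis dvdE le_add_diff_inverse mult.commute)
      define U where "U = A - replicate_mset (q * ?x) i"
      have AU: "A = replicate_mset (q * ?x) i + U"
        unfolding U_def using q by (intro multiset_eqI) simp
      have U: "supported J U" using A AU by (metis supported_add_iff)
      define A' where "A' = replicate_mset (q * ?y) ?j + U"
      have "val A' = val A"
        using trade_power[of "gap i" i] by (simp add: A'_def AU mult.assoc)
      moreover have "supported J A'"
        using U add_gap_in[of i] add_gap_le[OF \<open>J \<in> N\<close> step.hyps(2)]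
        by (auto simp: A'_def supported_def split: if_splits)
      moreover have "\<forall>l < Suc i. count A' l = count B l"
        using agree q gap_pos[of i] by (auto simp: A'_def AU less_Suc_eq)
      ultimately have "E A' B" using step.IH B v by simp
      moreover have "E A A'"
        unfolding A'_def by (subst AU) (rule trades[OF True supported_imp_subset[OF U]])
      ultimately show ?thesis using trans by blast
    qed
    show ?case
    proof (cases "count B i \<le> count A i")
      case True
      then show ?thesis using * step.prems by blast
    next
      case False
      then have "E B A" using *[of B A] step.prems by simp
      then show ?thesis by (rule sym)
    qed
  qed
  then show ?thesis using J AB by simp
qed

section \<open>Atoms, omega and presentations for r < 1 < n\<close>

context
  assumes less_one: "r < 1" and n_gt_1: "n > 1"
begin

lemma n_less_d: "n < d"
  using less_one d_pos by (simp add: r_def)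

text \<open>In a proper decomposition every summand is smaller than \<open>r ^ k\<close>, so its
  exponent exceeds \<open>k\<close>. Comparing numerators, \<open>n\<close> then divides a power of
  \<open>d\<close>, which is impossible for coprime \<open>n > 1\<close>.\<close>

lemma power_in_atoms:
  assumes "k \<in> N"
  shows "r ^ k \<in> atoms S"
proof -
  have "x = 0 \<or> y = 0" if xy: "x \<in> S" "y \<in> S" "r ^ k = x + y" for x y
  proof (rule ccontr)
    assume nz: "\<not> (x = 0 \<or> y = 0)"
    obtain A B where AB: "x = val A" "y = val B" using xy by (auto simp: S_eq)
    then have ne: "A \<noteq> {#}" "B \<noteq> {#}" using nz by auto
    have "Suc k \<le> i" if i: "i \<in># A + B" for i
    proof -
      obtain C where C: "A + B = add_mset i C" using multi_member_split[OF i] by blast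
      have "C \<noteq> {#}"
      proof
        assume "C = {#}"
        then have "size (A + B) = 1" using C by simp
        then show False using ne by (auto simp: add_is_1)
      qed
      moreover have "r ^ k = r ^ i + val C" using xy AB C by (metis val_add_mset val_union)
      ultimately have "r ^ i < r ^ k" using val_pos by simp
      then have "\<not> i \<le> k" using r_pos less_one power_decreasing[of i k r] by auto
      then show ?thesis by simp
    qed
    then obtain J m where "val (A + B) * of_nat d ^ J = r ^ Suc k * of_nat m"
      using val_numerator[of "A + B" "Suc k"] by blast
    then have "r ^ k * of_nat d ^ J = r ^ k * (r * of_nat m)"
      using xy AB by simp
    then have "of_nat d ^ J = r * of_nat m" using r_pos by simp
    then have "of_nat (d ^ Suc J) = (of_nat (n * m) :: rat)"
      using d_pos by (simp add: r_def)
    then have "d ^ Suc J = n * m" by (simp only: of_nat_eq_iff)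
    then have "n dvd d ^ Suc J" by simp
    moreover have "coprime n (d ^ Suc J)" using coprime by (simp del: power_Suc)
    ultimately have "n = 1" by (metis coprime_absorb_left nat_dvd_1_iff_1)
    then show False using n_gt_1 by simp
  qed
  moreover have "r ^ k \<in> S" using multiple_in_S[OF assms, of 1] by simp
  ultimately show ?thesis using r_pos unfolding atoms_def munits_S by auto
qed

lemma omega_one_infinite: "\<not> omega S 1 < \<infinity>"
proof
  assume "omega S 1 < \<infinity>"
  then obtain B where B: "\<And>z. z \<in> factorizations S \<Longrightarrow> mdvd S 1 (sum_mset z) \<Longrightarrow>
      \<exists>w. w \<subseteq># z \<and> size w \<le> B \<and> mdvd S 1 (sum_mset w)"
    unfolding omega_finite_iff by blast
  obtain K where K: "\<And>j. j \<ge> K \<Longrightarrow> j \<in> N" using conductor by blast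
  \<comment> \<open>Large enough that \<open>B\<close> copies of \<open>r ^ j\<close> sum to less
    than 1.\<close>
  define j where "j = K + B * n"
  \<comment> \<open>Bernoulli's inequality for \<open>(1 + 1 / n) ^ l\<close>, cleared of
    denominators, with \<open>d \<ge> n + 1\<close>.\<close>
  have growth: "(n + l) * n ^ l \<le> n * d ^ l" for l
  proof (induction l)
    case (Suc l)
    have "(n + Suc l) * n ^ Suc l = (n * (n + Suc l)) * n ^ l" by (simp only: power_Suc ac_simps)
    also have "\<dots> \<le> (Suc n * (n + l)) * n ^ l" by (intro mult_right_mono) auto
    also have "\<dots> = Suc n * ((n + l) * n ^ l)" by (simp only: mult.assoc)
    also have "\<dots> \<le> d * (n * d ^ l)" by (rule mult_le_mono[OF Suc_leI[OF n_less_d] Suc.IH])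
    finally show ?case by (simp add: ac_simps)
  qed simp
  have "B * n * n ^ j < (n + j) * n ^ j" using n_gt_1 by (simp add: j_def)
  also have "\<dots> \<le> n * d ^ j" by (rule growth)
  finally have "n * (B * n ^ j) < n * d ^ j" by (simp add: ac_simps)
  then have "B * n ^ j < d ^ j" by simp
  then have "(of_nat (B * n ^ j) :: rat) < of_nat (d ^ j)" by (simp only: of_nat_less_iff)
  then have small: "of_nat B * r ^ j < 1"
    using d_pos by (simp add: r_def power_divide)
  define z where "z = replicate_mset (d ^ j) (r ^ j)"
  have "z \<in> factorizations S"
    using power_in_atoms K by (auto simp: z_def factorizations_def j_def split: if_splits)
  moreover have "mdvd S 1 (sum_mset z)"
  proof -
    have "sum_mset z = of_nat (n ^ j)"
      using r_power_d[of j] by (simp add: z_def mult.commute)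
    also have "\<dots> = 1 + of_nat (n ^ j - 1) * r ^ 0"
      using n_pos by (simp add: of_nat_diff)
    finally show ?thesis using multiple_in_S[OF zero_in_N] unfolding mdvd_def by blast
  qed
  ultimately obtain w where w: "w \<subseteq># z" "size w \<le> B" "mdvd S 1 (sum_mset w)"
    using B by blast
  have "set_mset w \<subseteq> {r ^ j}"
    using set_mset_mono[OF w(1)] by (auto simp: z_def split: if_splits)
  then obtain q where q: "w = replicate_mset q (r ^ j)"
    using set_mset_subset_singletonD by metis
  then have "sum_mset w = of_nat q * r ^ j" by simp
  also have "\<dots> \<le> of_nat B * r ^ j" using w(2) q r_pos by simp
  also note small
  finally show False using mdvd_le[OF w(3)] by simp
qed

lemma inj_power: "inj (\<lambda>i. r ^ i)"
proof (rule injI)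
  fix i j :: nat assume "r ^ i = r ^ j"
  then show "i = j"
    using r_pos less_one power_strict_decreasing[of i j r] power_strict_decreasing[of j i r]
    by (metis nat_neq_iff order_less_irrefl)
qed

text \<open>The weights \<open>v\<close> satisfy \<open>n v\<^sub>i = (d - n) v\<^sub>i\<^sub>+\<^sub>1 + d v\<^sub>i\<^sub>+\<^sub>2\<close> beyond the conductor: the
  characteristic polynomial has, besides r, the root -1. Hence the weight identifies
  \<open>n r\<^sup>i\<close> with \<open>(d - n) r\<^sup>i\<^sup>+\<^sup>1 + d r\<^sup>i\<^sup>+\<^sup>2\<close>, which suffices to connect all R-classes, but it
  separates \<open>n r\<^sup>i\<close> from \<open>d r\<^sup>i\<^sup>+\<^sup>1\<close>.\<close>

lemma not_accp_presentable: "\<not> accp_presentable S"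
proof
  assume pres: "accp_presentable S"
  obtain K where K: "\<And>j. j \<ge> K \<Longrightarrow> j \<in> N" using conductor by blast
  \<comment> \<open>Up to \<open>K\<close> the weight agrees with the value, so trades within that
    range preserve it; the signs alternate only where all exponents lie in \<open>N\<close>.\<close>
  define v where "v i = (if i \<le> K then r ^ i else (- 1) ^ (i - K) * r ^ K)" for i
  define pw where "pw = image_mset (\<lambda>i. r ^ i)"
  define weight where "weight z = (\<Sum>a\<in>#z. v (inv (\<lambda>i. r ^ i) a))" for z
  \<comment> \<open>The weight-preserving kernel pairs form a congruence, so \<open>\<sigma>\<close>
    presents \<open>S\<close> only if it is the whole kernel.\<close>
  define \<sigma> where "\<sigma> = {(z, z') \<in> kernel S. weight z = weight z'}"
  define E where "E A B \<longleftrightarrow> (pw A, pw B) \<in> class_rel S \<sigma>" for A B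
  have v_high: "v i = (- 1) ^ (i - K) * r ^ K" if "i \<ge> K" for i
    using that by (auto simp: v_def)
  have weight_union: "weight (z + z') = weight z + weight z'" for z z'
    by (simp add: weight_def)
  have weight_replicate: "weight (pw (replicate_mset q i)) = of_nat q * v i" for q i
    by (simp add: weight_def pw_def inv_f_f[OF inj_power])
  have pw_union: "pw (A + B) = pw A + pw B" for A B by (simp add: pw_def)
  have pw_fact: "pw A \<in> factorizations S" if "set_mset A \<subseteq> N" for A
    using that power_in_atoms by (auto simp: pw_def factorizations_def)
  have pw_kernel: "(pw A, pw B) \<in> kernel S"
    if "set_mset A \<subseteq> N" "set_mset B \<subseteq> N" "val A = val B" for A B
    using that pw_fact by (simp add: kernel_def) (simp add: pw_def sum_mset_image_power)
  have \<sigma>_kernel: "\<sigma> \<subseteq> kernel S" by (auto simp: \<sigma>_def)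
  have cong: "is_congruence S (class_rel S \<sigma>)" by (rule class_rel_congruence)
  have E_refl: "E A A" if "set_mset A \<subseteq> N" for A
    using cong pw_fact[OF that] by (simp add: E_def is_congruence_def)
  have E_sym: "E B A" if "E A B" for A B
    using cong that by (auto simp: E_def is_congruence_def dest: symD)
  have E_trans: "E A C" if "E A B" "E B C" for A B C
    using cong that unfolding E_def is_congruence_def by (meson transD)
  have E_weight: "E A B" if "set_mset A \<subseteq> N" "set_mset B \<subseteq> N" "val A = val B"
    "weight (pw A) = weight (pw B)" for A B
    using relation_subset_class_rel[OF \<sigma>_kernel] pw_kernel[OF that(1-3)] that(4)
    by (auto simp: E_def \<sigma>_def)
  have E_share: "E A B" if "set_mset A \<subseteq> N" "set_mset B \<subseteq> N" "val A = val B"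
    "i \<in># A" "i \<in># B" for A B i
  proof -
    have "r ^ i \<in># pw A \<inter># pw B" using that by (simp add: pw_def)
    then have "pw A \<inter># pw B \<noteq> {#}" by force
    then have "(pw A, pw B) \<in> Rrel S"
      using pw_kernel[OF that(1-3)] by (simp add: kernel_def Rrel_def)
    then show ?thesis using Rrel_subset_class_rel unfolding E_def by blast
  qed
  have trade: "E (replicate_mset (n ^ gap i) i + U) (replicate_mset (d ^ gap i) (i + gap i) + U)"
    (is "E (?L + U) (?R + U)")
    if i: "i \<in> N" and U: "set_mset U \<subseteq> N" for i U
  proof -
    have L: "set_mset ?L \<subseteq> N" and R: "set_mset ?R \<subseteq> N"
      using i add_gap_in[of i] by (auto split: if_splits)
    have eq: "val ?L = val ?R" using trade_power[of "gap i" i] by simp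
    show ?thesis
    \<comment> \<open>A nonempty \<open>U\<close> gives both sides a common atom, which leaves only
      the bare trade.\<close>
    proof (cases "U = {#}")
      case False
      then obtain j where j: "j \<in># U" by (meson multiset_nonemptyE)
      show ?thesis by (rule E_share[where i = j]) (use L R U eq j in auto)
    next
      case True
      have "E ?L ?R"
      proof (cases "i < K")
        case True
        then have "i + gap i \<le> K" using add_gap_le K by blast
        then have "weight (pw ?L) = weight (pw ?R)"
          unfolding weight_replicate using True trade_power[of "gap i" i] by (simp add: v_def)
        then show ?thesis using E_weight L R eq by blast
      next
        case False
        then have N': "Suc i \<in> N" "Suc (Suc i) \<in> N" using K by auto
        then have g: "gap i = 1" using add_gap_le[of "Suc i" i] gap_pos[of i] by simp
        \<comment> \<open>\<open>C\<close> has the weight of \<open>?L\<close> and shares the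
          exponent \<open>Suc i\<close> with \<open>?R\<close>, so it links the two although their
          weights differ.\<close>
        define C where "C = replicate_mset (d - n) (Suc i) + replicate_mset d (Suc (Suc i))"
        have C: "set_mset C \<subseteq> N" using N' by (auto simp: C_def split: if_splits)
        have "val C = of_nat (d - n) * r ^ Suc i + of_nat n * r ^ Suc i"
          unfolding C_def val_union val_replicate r_power_mult[of "Suc i"] ..
        also have "\<dots> = of_nat d * r ^ Suc i"
          using n_less_d by (simp add: of_nat_diff algebra_simps)
        finally have vC: "val C = val ?R" using g by simp
        have "weight (pw ?L) = weight (pw C)"
          unfolding C_def pw_union weight_union weight_replicate
          using False n_less_d by (simp add: g v_high Suc_diff_le of_nat_diff algebra_simps)
        then have "E ?L C" using E_weight L C eq vC by simp
        moreover have "Suc i \<in># C" "Suc i \<in># ?R"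
          using n_less_d g by (auto simp: C_def)
        then have "E C ?R" using E_share[OF C R vC] by blast
        ultimately show ?thesis by (rule E_trans)
      qed
      then show ?thesis using True by simp
    qed
  qed
  have "kernel S \<subseteq> class_rel S \<sigma>"
  proof
    fix p assume p: "p \<in> kernel S"
    obtain z z' where zz: "p = (z, z')" by (cases p)
    have z: "z \<in> factorizations S" "z' \<in> factorizations S" "sum_mset z = sum_mset z'"
      using p zz by (auto simp: kernel_def)
    obtain A where A: "set_mset A \<subseteq> N" "z = pw A"
      using factorization_index[OF z(1)] unfolding pw_def .
    obtain B where B: "set_mset B \<subseteq> N" "z' = pw B"
      using factorization_index[OF z(2)] unfolding pw_def .
    have "val A = val B"
      using z(3) A(2) B(2) by (simp add: pw_def sum_mset_image_power)
    with E_refl E_sym E_trans trade A(1) B(1) have "E A B" by (rule trades_generate)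
    then show "p \<in> class_rel S \<sigma>" by (simp add: E_def zz A B)
  qed
  then have "presentation S \<sigma>"
    using pres \<sigma>_kernel accp_presentable_iff[OF exp_puiseux.zero S_add] by blast
  moreover have "is_congruence S \<sigma>"
    using kernel_congruence[of S] weight_union
    unfolding is_congruence_def \<sigma>_def by (fastforce simp: sym_def trans_def kernel_def)
  ultimately have "kernel S \<subseteq> \<sigma>" unfolding presentation_def by blast
  \<comment> \<open>The trade at \<open>K\<close> is the witness: its sides have weights
    \<open>n * r ^ K\<close> and \<open>- d * r ^ K\<close>.\<close>
  moreover have "(pw (replicate_mset n K), pw (replicate_mset d (Suc K))) \<in> kernel S"
    using K r_power_mult[of K] by (intro pw_kernel) (auto split: if_splits)
  ultimately have "of_nat n * v K = of_nat d * v (Suc K)"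
    unfolding \<sigma>_def weight_replicate[symmetric] by blast
  then have "of_nat (n + d) * r ^ K = 0" by (simp add: v_def algebra_simps)
  then show False using r_pos n_pos by simp
qed

end

end

theorem mainTheorem15:
  fixes r :: rat and N :: "nat set"
  assumes "r > 0" and "numerical_monoid N" and "atomic (exp_puiseux r N)"
  shows "(r \<ge> 1 \<longleftrightarrow> accp (exp_puiseux r N))
       \<and> (accp (exp_puiseux r N) \<longleftrightarrow> accp_presentable (exp_puiseux r N))
       \<and> (accp_presentable (exp_puiseux r N) \<longleftrightarrow>
            (\<forall>a \<in> atoms (exp_puiseux r N). omega (exp_puiseux r N) a < \<infinity>))"
proof -
  obtain p q where pq: "r = Fract p q" "q > 0" "coprime p q" by (cases r) auto
  then have "p > 0" using assms(1) by (simp add: zero_less_Fract_iff)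
  have "r = of_nat (nat p) / of_nat (nat q)"
    using pq \<open>p > 0\<close> by (simp add: Fract_of_int_quotient)
  moreover have "coprime (nat p) (nat q)"
    using pq \<open>p > 0\<close> by (simp add: coprime_int_iff[symmetric] del: coprime_int_iff)
  ultimately interpret exponential_puiseux "nat p" "nat q" N r
    using pq \<open>p > 0\<close> assms(2) by unfold_locales auto
  \<comment> \<open>All four conditions hold for r at least 1 and all fail for r below 1, where the
    atom \<open>1 = r ^ 0\<close> refutes the one on \<open>omega\<close>.\<close>
  show ?thesis
  proof (cases "r \<ge> 1")
    case True
    then have "accp S" by (rule accp_if_ge_one)
    moreover from this have "accp_presentable S"
      using accp_imp_accp_presentable exp_puiseux.zero S_add by blast
    ultimately show ?thesis using True omega_finite_if_ge_one by blast
  next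
    case False
    then have less: "r < 1" by simp
    note gt = one_less_n_if_atomic[OF less assms(3)]
    have "1 \<in> atoms S" using power_in_atoms[OF less gt zero_in_N] by simp
    then show ?thesis
      using False not_accp_if_less_one[OF less] not_accp_presentable[OF less gt]
        omega_one_infinite[OF less gt] by blast
  qed
qed

end
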